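(* Let $g_n$ be the number of unlabeled graphs on $n$ nodes. Then $$\frac{2^{\binom{n}{2}}}{n!} \;\leq\; g_n \;\leq\; \frac{2^{\binom{n}{2}}}{n!}\left(1 + \frac{4n^4}{2^n}\right).$$
   Context: Graphs are simple and undirected. Two labeled graphs on the node set $\{0,1,\ldots,n-1\}$ are equivalent if some relabeling (permutation of the nodes) makes them equal. An unlabeled graph on $n$ nodes is an equivalence class of labeled graphs; thus $g_n$ is the number of isomorphism classes of undirected graphs on $\{0,1,\ldots,n-1\}$. *)

theory Defs
  imports Complex_Main "HOL-Combinatorics.Permutations"
begin

(* A simple undirected labeled graph on the nodes 0, ..., n - 1 is identified with
   its set of edges, an edge being a two-element set of nodes. *)
definition labeled_graphs :: "nat \<Rightarrow> nat set set set" where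
  "labeled_graphs n = Pow {e. e \<subseteq> {0..<n} \<and> card e = 2}"

definition relabel :: "(nat \<Rightarrow> nat) \<Rightarrow> nat set set \<Rightarrow> nat set set" where
  "relabel p G = (\<lambda>e. p ` e) ` G"

definition graph_equiv :: "nat \<Rightarrow> (nat set set \<times> nat set set) set" where
  "graph_equiv n =
     {(G, H). G \<in> labeled_graphs n \<and> H \<in> labeled_graphs n \<and>
              (\<exists>p. p permutes {0..<n} \<and> relabel p G = H)}"

definition unlabeled_graphs :: "nat \<Rightarrow> nat set set set set" where
  "unlabeled_graphs n = labeled_graphs n // graph_equiv n"

definition num_unlabeled_graphs :: "nat \<Rightarrow> nat" where
  "num_unlabeled_graphs n = card (unlabeled_graphs n)"

lemma finite_labeled_graphs: "finite (labeled_graphs n)"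
  by (simp add: labeled_graphs_def)

lemma relabel_id: "relabel id G = G"
  by (simp add: relabel_def)

lemma relabel_comp: "relabel q (relabel p G) = relabel (q \<circ> p) G"
  by (simp add: relabel_def image_image)

lemma equiv_graph_equiv: "equiv (labeled_graphs n) (graph_equiv n)"
proof (rule equivI)
  show "graph_equiv n \<subseteq> labeled_graphs n \<times> labeled_graphs n"
    by (auto simp: graph_equiv_def)
  show "refl_on (labeled_graphs n) (graph_equiv n)"
    by (auto simp: refl_on_def graph_equiv_def intro!: exI[of _ id] permutes_id relabel_id)
  show "sym (graph_equiv n)"
  proof (rule symI)
    fix G H assume "(G, H) \<in> graph_equiv n"
    then obtain p where p: "G \<in> labeled_graphs n" "H \<in> labeled_graphs n"
        "p permutes {0..<n}" "relabel p G = H"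
      by (auto simp: graph_equiv_def)
    have "relabel (inv p) H = G"
      using p(3) by (simp add: p(4)[symmetric] relabel_comp permutes_inv_o(2) relabel_id)
    then show "(H, G) \<in> graph_equiv n"
      using p permutes_inv[OF p(3)] by (auto simp: graph_equiv_def)
  qed
  show "trans (graph_equiv n)"
  proof (rule transI)
    fix G H K assume "(G, H) \<in> graph_equiv n" "(H, K) \<in> graph_equiv n"
    then obtain p q where pq: "G \<in> labeled_graphs n" "K \<in> labeled_graphs n"
        "p permutes {0..<n}" "q permutes {0..<n}" "relabel q (relabel p G) = K"
      by (auto simp: graph_equiv_def)
    then show "(G, K) \<in> graph_equiv n"
      using permutes_compose[OF pq(3,4)] by (auto simp: graph_equiv_def relabel_comp)
  qed
qed

end

theory Submission
  imports Defs "HOL-Algebra.Group_Action"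
begin

text \<open>
  By Burnside's lemma, \<open>n!\<close> times the number of unlabeled graphs is the sum, over all
  permutations \<open>p\<close> of the nodes, of the number of labeled graphs that \<open>p\<close> leaves invariant
  (\<open>burnside_graphs\<close>). The identity contributes all \<open>2 ^ (n choose 2)\<close> labeled graphs, which is
  the lower bound. The upper bound says that all other permutations together contribute at most
  \<open>4 n\<^sup>4 / 2\<^sup>n\<close> times as much.

  Consider a permutation \<open>p\<close> with \<open>m\<close> fixed nodes. An invariant graph is a union of orbits of \<open>p\<close>
  on the set \<open>E\<close> of possible edges. Every orbit that is not a fixed edge has at least two
  elements, so with \<open>F\<close> the number of fixed edges there are at most \<open>(card E + F) / 2\<close> orbits
  (\<open>card_invariant_subsets_le\<close>). Double counting gives \<open>2 F \<le> m (m - 1) + (n - m)\<close>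
  (\<open>card_fixed_edges_le\<close>). Hence the proportion of invariant graphs is at most
  \<open>2\<close> to the power \<open>(m (m - 2) - n (n - 2)) / 4\<close>. At most \<open>n! / m!\<close> permutations have exactly
  \<open>m\<close> fixed points, and for \<open>p \<noteq> id\<close> we have \<open>m \<le> n - 2\<close>.

  The exponent separates into a part in \<open>m\<close> and the same part in \<open>n\<close>, and so does the
  quotient of factorials. So with \<open>w m = 2 powr (m (m - 2) / 4) / m!\<close> the
  permutations other than the identity contribute at most the sum of \<open>w m / w n\<close> over
  \<open>m \<le> n - 2\<close>, relative to the identity (\<open>sum_card_invariant_graphs_le\<close>). The term
  \<open>m = n - 2\<close>, which comes from the transpositions, equals \<open>4 n (n - 1) / 2\<^sup>n\<close>.
  Since \<open>w\<close> eventually grows faster than any exponential, the whole sum is a bounded multiple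
  of this term, and the target allows the factor \<open>n\<^sup>3 / (n - 1)\<close>; that this is enough for
  small \<open>n\<close> as well is the numerical content of \<open>sum_weight_le\<close>.
\<close>

section \<open>Burnside's lemma for relabelings\<close>

lemma relabel_in_labeled_graphs:
  assumes p: "p permutes {0..<n}" and G: "G \<in> labeled_graphs n"
  shows "relabel p G \<in> labeled_graphs n"
proof -
  have "p ` e \<subseteq> {0..<n} \<and> card (p ` e) = 2" if "e \<in> G" for e
  proof -
    have e: "e \<subseteq> {0..<n}" "card e = 2"
      using G that by (auto simp: labeled_graphs_def)
    have "p ` e \<subseteq> p ` {0..<n}"
      using e(1) by blast
    then show ?thesis
      using e(2) permutes_image[OF p] card_image[OF permutes_inj_on[OF p, of e]] by simp
  qed
  then show ?thesis
    by (auto simp: relabel_def labeled_graphs_def)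
qed

definition sym_nodes :: "nat \<Rightarrow> (nat \<Rightarrow> nat) monoid" where
  "sym_nodes n = \<lparr>carrier = {p. p permutes {0..<n}}, mult = (\<circ>), one = id\<rparr>"

lemma group_sym_nodes: "group (sym_nodes n)"
proof (rule groupI)
  fix p assume "p \<in> carrier (sym_nodes n)"
  then have p: "p permutes {0..<n}"
    by (simp add: sym_nodes_def)
  show "\<exists>q\<in>carrier (sym_nodes n). q \<otimes>\<^bsub>sym_nodes n\<^esub> p = \<one>\<^bsub>sym_nodes n\<^esub>"
    using permutes_inv[OF p] permutes_inv_o(2)[OF p] by (auto simp: sym_nodes_def)
qed (auto simp: sym_nodes_def permutes_id permutes_compose comp_assoc)

text \<open>The action is cut off outside the labeled graphs because the bijections of a set are
  represented extensionally.\<close>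

definition act :: "nat \<Rightarrow> (nat \<Rightarrow> nat) \<Rightarrow> nat set set \<Rightarrow> nat set set" where
  "act n p = restrict (relabel p) (labeled_graphs n)"

lemma act_Bij:
  assumes p: "p permutes {0..<n}"
  shows "act n p \<in> Bij (labeled_graphs n)"
proof -
  have "relabel p ` labeled_graphs n \<subseteq> labeled_graphs n"
    using relabel_in_labeled_graphs[OF p] by blast
  moreover have "inj_on (relabel p) (labeled_graphs n)"
  proof (rule inj_onI)
    fix G H assume "relabel p G = relabel p H"
    moreover have "inj (\<lambda>e. p ` e)"
      using inj_image_eq_iff[OF permutes_inj[OF p]] by (auto simp: inj_def)
    ultimately show "G = H"
      by (simp add: relabel_def inj_image_eq_iff)
  qed
  ultimately have "bij_betw (relabel p) (labeled_graphs n) (labeled_graphs n)"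
    using endo_inj_surj[OF finite_labeled_graphs] by (simp add: bij_betw_def)
  then show ?thesis
    by (simp add: Bij_def act_def bij_betw_restrict_eq)
qed

lemma group_action_act: "group_action (sym_nodes n) (labeled_graphs n) (act n)"
proof -
  have "act n (p \<circ> q) = compose (labeled_graphs n) (act n p) (act n q)"
    if "q permutes {0..<n}" for p q
    using relabel_in_labeled_graphs[OF that]
    by (auto simp: act_def compose_def relabel_comp fun_eq_iff)
  then have "act n \<in> hom (sym_nodes n) (BijGroup (labeled_graphs n))"
    by (auto simp: hom_def sym_nodes_def BijGroup_def act_Bij)
  then show ?thesis
    by (intro group_action.intro group_hom.intro group_sym_nodes group_BijGroup)
       (simp add: group_hom_axioms_def)
qed

lemma orbits_act: "orbits (sym_nodes n) (labeled_graphs n) (act n) = unlabeled_graphs n"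
proof -
  have "orbit (sym_nodes n) (act n) G = graph_equiv n `` {G}" if "G \<in> labeled_graphs n" for G
    using that relabel_in_labeled_graphs
    by (auto simp: orbit_def graph_equiv_def sym_nodes_def act_def)
  then show ?thesis
    by (auto simp: orbits_def unlabeled_graphs_def quotient_def)
qed

lemma burnside_graphs:
  "num_unlabeled_graphs n * fact n
     = (\<Sum>p | p permutes {0..<n}. card {G \<in> labeled_graphs n. relabel p G = G})"
proof -
  interpret group_action "sym_nodes n" "labeled_graphs n" "act n"
    by (rule group_action_act)
  have "order (sym_nodes n) = fact n"
    by (simp add: order_def sym_nodes_def card_permutations)
  moreover have "carrier (sym_nodes n) = {p. p permutes {0..<n}}" "finite {p. p permutes {0..<n}}"
    by (simp_all add: sym_nodes_def finite_permutations)
  moreover have "invariants (labeled_graphs n) (act n) p = {G \<in> labeled_graphs n. relabel p G = G}"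
    for p
    by (auto simp: invariants_def act_def)
  ultimately show ?thesis
    using burnside finite_labeled_graphs
    by (simp add: orbits_act num_unlabeled_graphs_def)
qed

section \<open>Subsets invariant under an injection\<close>

text \<open>An invariant set is determined by its trace on a set of representatives of the orbits of
  \<open>f\<close>. Taking a determining set \<open>T\<close> of minimal size avoids any talk of orbits: \<open>f\<close> maps the
  moved elements of \<open>T\<close> injectively out of \<open>T\<close>, so at most half of the elements moved by \<open>f\<close>
  are in \<open>T\<close>.\<close>

lemma card_invariant_subsets_le:
  fixes f :: "'a \<Rightarrow> 'a"
  assumes fin: "finite E" and inj: "inj f" and into: "f ` E \<subseteq> E"
  shows "(card {G. G \<subseteq> E \<and> f ` G = G})\<^sup>2 \<le> 2 ^ (card E + card {e \<in> E. f e = e})"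
proof -
  define I where "I = {G. G \<subseteq> E \<and> f ` G = G}"
  define F where "F = {e \<in> E. f e = e}"
  define determines where
    "determines T \<longleftrightarrow> T \<subseteq> E \<and> (\<forall>G\<in>I. \<forall>H\<in>I. G \<inter> T = H \<inter> T \<longrightarrow> G = H)" for T
  have "determines E"
    unfolding determines_def I_def by blast
  then obtain T where T: "determines T" and min: "\<And>U. determines U \<Longrightarrow> card T \<le> card U"
    using ex_has_least_nat[of determines E card] by blast
  have TE: "T \<subseteq> E" and finT: "finite T"
    using T fin finite_subset by (auto simp: determines_def)
  have mem: "f x \<in> G \<longleftrightarrow> x \<in> G" if "G \<in> I" for G x
    using that inj_image_mem_iff[OF inj, of x G] by (simp add: I_def)
  \<comment> \<open>If \<open>x\<close> and \<open>f x \<noteq> x\<close> were both in \<open>T\<close>, then \<open>f x\<close> would be redundant.\<close>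
  have moved: "f x \<notin> T" if x: "x \<in> T" "f x \<noteq> x" for x
  proof
    assume fx: "f x \<in> T"
    have "determines (T - {f x})"
      unfolding determines_def
    proof (intro conjI ballI impI)
      show "T - {f x} \<subseteq> E"
        using TE by blast
      fix G H assume GH: "G \<in> I" "H \<in> I" and eq: "G \<inter> (T - {f x}) = H \<inter> (T - {f x})"
      have "x \<in> T - {f x}"
        using x by auto
      then have "x \<in> G \<longleftrightarrow> x \<in> H"
        using eq by blast
      then have "f x \<in> G \<longleftrightarrow> f x \<in> H"
        using mem GH by simp
      then have "G \<inter> T = H \<inter> T"
        using eq by blast
      then show "G = H"
        using T GH by (simp add: determines_def)
    qed
    then have "card T \<le> card (T - {f x})"
      by (rule min)
    then show False
      using card_Diff1_less[OF finT fx] by simp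
  qed
  have "card T + card (T - F) = card (T \<union> f ` (T - F))"
  proof -
    have "T \<inter> f ` (T - F) = {}"
      using moved TE by (auto simp: F_def)
    then show ?thesis
      using finT card_image[OF inj_on_subset[OF inj, of "T - F"]]
      by (simp add: card_Un_disjoint)
  qed
  also have "\<dots> \<le> card E"
    using TE into by (intro card_mono fin) blast
  finally have "card T + card (T - F) \<le> card E" .
  moreover have "card T \<le> card (T - F) + card F"
  proof -
    have "card T \<le> card ((T - F) \<union> F)"
      using finT fin by (intro card_mono) (auto simp: F_def)
    then show ?thesis
      using card_Un_le[of "T - F" F] by linarith
  qed
  ultimately have cardT: "2 * card T \<le> card E + card F"
    by linarith
  have "card I \<le> card (Pow T)"
  proof (rule card_inj_on_le)
    show "inj_on (\<lambda>G. G \<inter> T) I"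
      using T by (auto simp: inj_on_def determines_def)
  qed (use finT in auto)
  then have "(card I)\<^sup>2 \<le> (2 ^ card T)\<^sup>2"
    using finT by (simp add: card_Pow power_mono)
  also have "\<dots> = 2 ^ (2 * card T)"
    by (simp add: power_mult[symmetric] mult.commute)
  also have "\<dots> \<le> 2 ^ (card E + card F)"
    using cardT by (rule power_increasing) simp
  finally show ?thesis
    by (simp add: I_def F_def)
qed

section \<open>Graphs invariant under a given relabeling\<close>

text \<open>Count the pairs of a fixed edge and one of its ends. If an end is a fixed node, then so is
  the other one; if an end \<open>x\<close> is moved, then the edge must be \<open>{x, p x}\<close>.\<close>

lemma card_fixed_edges_le:
  assumes p: "p permutes A" and fin: "finite A" and m: "card {x \<in> A. p x = x} = m"
  shows "2 * card {e. e \<subseteq> A \<and> card e = 2 \<and> p ` e = e} \<le> m * (m - 1) + (card A - m)"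
proof -
  define F where "F = {e. e \<subseteq> A \<and> card e = 2 \<and> p ` e = e}"
  define M where "M = {x \<in> A. p x = x}"
  have finM: "finite M" and MA: "M \<subseteq> A" and finF: "finite F"
    using fin by (auto simp: M_def F_def)
  have fixed: "card {e \<in> F. x \<in> e} \<le> m - 1" if x: "x \<in> M" for x
  proof -
    have "{e \<in> F. x \<in> e} \<subseteq> (\<lambda>y. {x, y}) ` (M - {x})"
    proof
      fix e assume "e \<in> {e \<in> F. x \<in> e}"
      then have e: "e \<subseteq> A" "card e = 2" "p ` e = e" "x \<in> e"
        by (auto simp: F_def)
      obtain y where y: "e = {x, y}" "y \<noteq> x"
        using e(2,4) by (auto simp: card_2_iff)
      have "p x = x"
        using x by (simp add: M_def)
      then have "p y = y"
        using e(3) y permutes_inj[OF p] by (auto simp: doubleton_eq_iff inj_def)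
      then show "e \<in> (\<lambda>y. {x, y}) ` (M - {x})"
        using e(1) y by (auto simp: M_def)
    qed
    then have "card {e \<in> F. x \<in> e} \<le> card (M - {x})"
      by (rule surj_card_le[rotated]) (simp add: finM)
    then show ?thesis
      using x finM m by (simp add: M_def)
  qed
  have moved: "card {e \<in> F. x \<in> e} \<le> 1" if x: "x \<in> A - M" for x
  proof -
    have "{e \<in> F. x \<in> e} \<subseteq> {{x, p x}}"
    proof
      fix e assume "e \<in> {e \<in> F. x \<in> e}"
      then have e: "card e = 2" "p ` e = e" "x \<in> e"
        by (auto simp: F_def)
      have "p x \<in> e" "p x \<noteq> x"
        using e x by (auto simp: M_def)
      then show "e \<in> {{x, p x}}"
        using e(1,3) by (auto simp: card_2_iff)
    qed
    then show ?thesis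
      using card_mono[of "{{x, p x}}"] by simp
  qed
  have "2 * card F = (\<Sum>e\<in>F. card {x \<in> A. x \<in> e})"
  proof -
    have "card {x \<in> A. x \<in> e} = 2" if "e \<in> F" for e
    proof -
      have "{x \<in> A. x \<in> e} = e"
        using that by (auto simp: F_def)
      then show ?thesis
        using that by (simp add: F_def)
    qed
    then show ?thesis
      by simp
  qed
  also have "\<dots> = (\<Sum>x\<in>A. card {e \<in> F. x \<in> e})"
    using sum_multicount_gen[of F A "\<lambda>e x. x \<in> e" "\<lambda>x. card {e \<in> F. x \<in> e}"] fin finF
    by simp
  also have "\<dots> = (\<Sum>x\<in>A - M. card {e \<in> F. x \<in> e}) + (\<Sum>x\<in>M. card {e \<in> F. x \<in> e})"
    using fin MA by (rule sum.subset_diff[rotated])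
  also have "\<dots> \<le> (\<Sum>x\<in>A - M. 1) + (\<Sum>x\<in>M. m - 1)"
    by (intro add_mono sum_mono fixed moved) auto
  also have "\<dots> = m * (m - 1) + (card A - m)"
    using m by (simp add: M_def[symmetric] card_Diff_subset[OF finM MA])
  finally show ?thesis
    by (simp add: F_def)
qed

text \<open>Writing the bound on the fixed edges as \<open>2 F \<le> m (m - 2) + n\<close>, and
  \<open>2 * (n choose 2)\<close> as \<open>n (n - 2) + n\<close>, turns the exponent into a difference of the same
  quadratic at \<open>m\<close> and at \<open>n\<close>.\<close>

lemma card_invariant_graphs_le:
  assumes p: "p permutes {0..<n}" and m: "card {x \<in> {0..<n}. p x = x} = m"
  shows "real (card {G \<in> labeled_graphs n. relabel p G = G})
     \<le> 2 ^ (n choose 2)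
         * 2 powr ((real m * (real m - 2) - real n * (real n - 2)) / 4)"
proof -
  define E where "E = {e. e \<subseteq> {0..<n} \<and> card e = 2}"
  define k where "k = card {G \<in> labeled_graphs n. relabel p G = G}"
  define F where "F = card {e \<in> E. p ` e = e}"
  have finE: "finite E"
    by (simp add: E_def)
  have cardE: "card E = n choose 2"
    using n_subsets[of "{0..<n}" 2] by (simp add: E_def)
  have "(\<lambda>e. p ` e) ` E \<subseteq> E"
    using relabel_in_labeled_graphs[OF p, of E] by (simp add: labeled_graphs_def relabel_def E_def)
  moreover have "inj (\<lambda>e. p ` e)"
    using inj_image_eq_iff[OF permutes_inj[OF p]] by (auto simp: inj_def)
  moreover have "{G \<in> labeled_graphs n. relabel p G = G} = {G. G \<subseteq> E \<and> (\<lambda>e. p ` e) ` G = G}"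
    by (auto simp: labeled_graphs_def relabel_def E_def)
  ultimately have "k\<^sup>2 \<le> 2 ^ ((n choose 2) + F)"
    using card_invariant_subsets_le[OF finE, of "\<lambda>e. p ` e"] by (simp add: k_def F_def cardE)
  then have "real (k\<^sup>2) \<le> real (2 ^ ((n choose 2) + F))"
    by (rule of_nat_mono)
  also have "\<dots> = 2 powr (real (n choose 2) + real F)"
    by (simp add: powr_realpow flip: of_nat_add)
  finally have k2: "(real k)\<^sup>2 \<le> 2 powr (real (n choose 2) + real F)"
    by simp
  have mn: "m \<le> n"
    using card_mono[of "{0..<n}" "{x \<in> {0..<n}. p x = x}"] by (simp add: m[symmetric] subset_iff)
  have "2 * F \<le> m * (m - 1) + (n - m)"
    using card_fixed_edges_le[OF p _ m] by (simp add: F_def E_def conj_assoc)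
  then have "real (2 * F) \<le> real (m * (m - 1) + (n - m))"
    by (rule of_nat_mono)
  also have "\<dots> = real m * (real m - 2) + real n"
    using mn by (cases m) (simp_all add: algebra_simps of_nat_diff)
  finally have F: "2 * real F \<le> real m * (real m - 2) + real n"
    by simp
  have choose: "2 * real (n choose 2) = real n * (real n - 1)"
    by (cases n) (simp_all add: choose_two field_char_0_class.of_nat_div mod_eq_0_iff_dvd
        algebra_simps)
  let ?d = "(real m * (real m - 2) - real n * (real n - 2)) / 4"
  have "(real k)\<^sup>2 \<le> 2 powr (2 * (real (n choose 2) + ?d))"
  proof (rule order_trans[OF k2 powr_mono])
    have square: "real n * (real n - 2) = 2 * real (n choose 2) - real n"
      using choose by (simp add: algebra_simps)
    show "real (n choose 2) + real F \<le> 2 * (real (n choose 2) + ?d)"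
      unfolding square using F by (simp add: field_simps)
  qed simp
  also have "\<dots> = (2 powr (real (n choose 2) + ?d))\<^sup>2"
    by (simp only: power2_eq_square mult_2 powr_add)
  finally have "real k \<le> 2 powr (real (n choose 2) + ?d)"
    by (rule power2_le_imp_le) simp
  then show ?thesis
    by (simp add: k_def powr_add powr_realpow)
qed

section \<open>Permutations with a given number of fixed points\<close>

text \<open>Choose the fixed points, then permute the remaining points in any way.\<close>

lemma card_permutations_fixing_le:
  assumes "finite A" and "m \<le> card A"
  shows "real (card {p. p permutes A \<and> card {x \<in> A. p x = x} = m}) \<le> fact (card A) / fact m"
proof -
  let ?n = "card A"
  let ?\<M> = "{M. M \<subseteq> A \<and> card M = m}"
  have fin: "finite ?\<M>"
    using assms(1) by simp
  have "{p. p permutes A \<and> card {x \<in> A. p x = x} = m} \<subseteq> (\<Union>M\<in>?\<M>. {p. p permutes A - M})"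
  proof
    fix p assume "p \<in> {p. p permutes A \<and> card {x \<in> A. p x = x} = m}"
    then have p: "p permutes A" "card {x \<in> A. p x = x} = m"
      by auto
    have "p permutes A - {x \<in> A. p x = x}"
      by (rule permutes_superset[OF p(1)]) auto
    then show "p \<in> (\<Union>M\<in>?\<M>. {p. p permutes A - M})"
      using p(2) by (intro UN_I[of "{x \<in> A. p x = x}"]) auto
  qed
  then have "card {p. p permutes A \<and> card {x \<in> A. p x = x} = m}
      \<le> card (\<Union>M\<in>?\<M>. {p. p permutes A - M})"
    using fin assms(1) by (intro card_mono) (auto intro: finite_permutations)
  also have "\<dots> \<le> (\<Sum>M\<in>?\<M>. card {p. p permutes A - M})"
    using fin by (rule card_UN_le)
  also have "\<dots> = (\<Sum>M\<in>?\<M>. fact (?n - m))"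
  proof (intro sum.cong refl card_permutations)
    fix M assume M: "M \<in> ?\<M>"
    then show "card (A - M) = ?n - m"
      using card_Diff_subset[of M A] finite_subset[OF _ assms(1)] by auto
  qed (use assms(1) in auto)
  also have "\<dots> = (?n choose m) * fact (?n - m)"
    using n_subsets[OF assms(1)] by simp
  finally have "real (card {p. p permutes A \<and> card {x \<in> A. p x = x} = m})
      \<le> real ((?n choose m) * fact (?n - m))"
    by (rule of_nat_mono)
  also have "\<dots> = fact ?n / fact m"
    using binomial_fact[OF assms(2), where 'a = real] by simp
  finally show ?thesis .
qed

lemma card_fixed_points_le:
  assumes p: "p permutes A" and "finite A" and "p \<noteq> id"
  shows "card {x \<in> A. p x = x} + 2 \<le> card A"
proof -
  obtain x where x: "p x \<noteq> x"
    using assms(3) by (auto simp: fun_eq_iff)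
  have xA: "x \<in> A" "p x \<in> A"
    using x permutes_not_in[OF p] permutes_in_image[OF p] by auto
  have "p (p x) \<noteq> p x"
    using x permutes_inj[OF p] by (auto simp: inj_def)
  then have "{x \<in> A. p x = x} \<subseteq> A - {x, p x}"
    using x by auto
  then have "card {x \<in> A. p x = x} \<le> card (A - {x, p x})"
    using assms(2) by (intro card_mono) auto
  also have "\<dots> = card A - 2"
    using x xA assms(2) by (simp add: card_Diff_subset)
  finally show ?thesis
    using card_mono[of A "{x, p x}"] x xA assms(2) by simp
qed

section \<open>Sums of weights\<close>

text \<open>The weight of \<open>m\<close> is, up to a factor that depends only on the number of nodes, the bound
  on the total proportion of invariant graphs over all permutations with \<open>m\<close> fixed nodes.\<close>

definition weight :: "nat \<Rightarrow> real" where
  "weight m = 2 powr (real m * (real m - 2) / 4) / fact m"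

lemma weight_pos: "weight m > 0"
  by (simp add: weight_def)

lemma weight_Suc: "weight m = real (m + 1) * 2 powr ((1 - 2 * real m) / 4) * weight (Suc m)"
proof -
  have "real m * (real m - 2) / 4
      = (1 - 2 * real m) / 4 + real (Suc m) * (real (Suc m) - 2) / 4"
    by (simp add: field_simps)
  then have "2 powr (real m * (real m - 2) / 4)
      = 2 powr ((1 - 2 * real m) / 4) * (2::real) powr (real (Suc m) * (real (Suc m) - 2) / 4)"
    by (simp only: powr_add)
  then show ?thesis
    by (simp add: weight_def divide_simps del: of_nat_Suc)
qed

text \<open>Two steps of the recurrence combine to an integral power of two. This compares the
  contribution of the transpositions with that of the identity.\<close>

lemma weight_add_2: "weight (m + 2) * (real (m + 2) * real (m + 1)) = 2 ^ m * weight m"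
proof -
  have "real (m + 2) * (real (m + 2) - 2) / 4 = real m + real m * (real m - 2) / 4"
    by (simp add: field_simps)
  then have "2 powr (real (m + 2) * (real (m + 2) - 2) / 4)
      = 2 ^ m * (2::real) powr (real m * (real m - 2) / 4)"
    by (simp only: powr_add powr_realpow zero_less_numeral)
  then show ?thesis
    by (simp add: weight_def divide_simps)
qed

text \<open>The powers in \<open>weight_Suc\<close> halve every two steps, so rational bounds on the first two of
  them suffice for all.\<close>

lemma weight_decay_le:
  "2 powr ((1 - 2 * real 0) / 4) \<le> (1.19::real)"
  "2 powr ((1 - 2 * real 1) / 4) \<le> (0.841::real)"
  "2 powr ((1 - 2 * real (m + 2)) / 4) = (2::real) powr ((1 - 2 * real m) / 4) / 2"
proof -
  have root: "2 powr (x / 4) \<le> b" if "2 powr x \<le> b ^ 4" "b \<ge> 0" for x b :: real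
  proof (rule power_le_imp_le_base)
    show "(2 powr (x / 4)) ^ Suc 3 \<le> b ^ Suc 3"
      using that(1) by (simp add: powr_powr flip: powr_realpow)
  qed (rule that(2))
  show "2 powr ((1 - 2 * real 0) / 4) \<le> (1.19::real)"
    by (rule root) (simp_all add: power4_eq_xxxx)
  show "2 powr ((1 - 2 * real 1) / 4) \<le> (0.841::real)"
    by (rule root) (simp_all add: power4_eq_xxxx powr_minus)
  have "(1 - 2 * real (m + 2)) / 4 = (1 - 2 * real m) / 4 - 1"
    by (simp add: field_simps)
  then show "2 powr ((1 - 2 * real (m + 2)) / 4) = (2::real) powr ((1 - 2 * real m) / 4) / 2"
    by (simp only: powr_diff) simp
qed

text \<open>The quotient \<open>s N\<close> of the sum by its last term satisfies
  \<open>s (N + 1) = 1 + (N + 1) * c N * s N\<close>, where \<open>c N\<close> decays like \<open>2 powr (- N / 2)\<close>. The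
  multiplier \<open>(N + 1) * c N\<close> exceeds \<open>1\<close> for \<open>N \<le> 6\<close> and stays below \<open>0.9\<close> from
  \<open>N = 7\<close> on. Hence \<open>s\<close> is computed explicitly up to \<open>7\<close> and bounded by a constant
  afterwards, while the required bound \<open>(N + 2)\<^sup>3 / (N + 1)\<close> grows quadratically.\<close>

lemma sum_weight_le:
  "real (N + 1) * (\<Sum>m\<le>N. weight m) \<le> real (N + 2) ^ 3 * weight N"
proof -
  define s where "s N = (\<Sum>m\<le>N. weight m) / weight N" for N
  define c where "c m = (2::real) powr ((1 - 2 * real m) / 4)" for m
  have c0: "c 0 \<le> 1.19" and c1: "c 1 \<le> 0.841" and c_step: "c (m + 2) = c m / 2" for m
    unfolding c_def by (fact weight_decay_le)+
  have s_0: "s 0 = 1"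
    by (simp add: s_def weight_def)
  have s_Suc: "s (Suc N) = 1 + real (N + 1) * c N * s N" for N
    using weight_pos[of N] weight_pos[of "Suc N"] weight_Suc[of N]
    by (simp add: s_def c_def divide_simps)
  have s_nonneg: "0 \<le> s N" for N
    using weight_pos by (simp add: s_def sum_nonneg less_imp_le)
  have step: "s (Suc N) \<le> 1 + real (N + 1) * b * B" if "c N \<le> b" "s N \<le> B" for N b B
  proof -
    have "0 \<le> c N"
      by (simp add: c_def)
    then have "real (N + 1) * c N * s N \<le> real (N + 1) * b * B"
      using that s_nonneg by (intro mult_mono) auto
    then show ?thesis
      by (simp add: s_Suc)
  qed
  have c_small: "c 2 \<le> 0.595" "c 3 \<le> 0.4205" "c 4 \<le> 0.2975" "c 5 \<le> 0.21025" "c 6 \<le> 0.14875"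
    using c0 c1 c_step[of 0] c_step[of 1] c_step[of 2] c_step[of 3] c_step[of 4]
    by (simp_all add: numeral_eq_Suc)
  have s1: "s 1 \<le> 2.19"
    using step[OF c0, of 1] s_0 by simp
  have s2: "s 2 \<le> 4.7"
    using step[OF c1 s1] by (simp add: numeral_2_eq_2)
  have s3: "s 3 \<le> 9.4"
    using step[OF c_small(1) s2] by simp
  have s4: "s 4 \<le> 17"
    using step[OF c_small(2) s3] by simp
  have s5: "s 5 \<le> 26.5"
    using step[OF c_small(3) s4] by simp
  have s6: "s 6 \<le> 35"
    using step[OF c_small(4) s5] by simp
  have s7: "s 7 \<le> 38"
    using step[OF c_small(5) s6] by simp
  have decay: "real (N + 1) * c N \<le> 0.9" if "N \<ge> 7" for N
    using that
  proof (induction N rule: less_induct)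
    case (less N)
    have "N = 7 \<or> N = 8 \<or> N = (N - 2) + 2 \<and> N - 2 \<ge> 7"
      using less.prems by linarith
    then consider "N = 7" | "N = 8" | M where "N = M + 2" "M \<ge> 7"
      by blast
    then show ?case
    proof cases
      case 1
      then show ?thesis
        using c_small(4) c_step[of 5] by simp
    next
      case 2
      then show ?thesis
        using c_small(5) c_step[of 6] by simp
    next
      case 3
      have "real (N + 1) * c N \<le> real (M + 1) * c M"
        unfolding 3(1) c_step using 3(2) by (simp add: c_def field_simps)
      then show ?thesis
        using less.IH[of M] 3 by simp
    qed
  qed
  \<comment> \<open>\<open>38\<close> bounds \<open>s 7\<close> and is preserved by the recurrence, as \<open>1 + 0.9 * 38 \<le> 38\<close>.\<close>
  have large: "s N \<le> 38" if "N \<ge> 7" for N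
    using that
  proof (induction N rule: nat_induct_at_least)
    case base
    show ?case
      by (fact s7)
  next
    case (Suc N)
    have "real (N + 1) * c N * s N \<le> 0.9 * 38"
      using decay[OF Suc.hyps] Suc.IH s_nonneg by (intro mult_mono) auto
    then show ?case
      by (simp add: s_Suc)
  qed
  have "real (N + 1) * s N \<le> real (N + 2) ^ 3"
  proof (cases "N \<ge> 7")
    case True
    have "real (N + 1) * s N \<le> real (N + 2) * 9 ^ 2"
      using large[OF True] s_nonneg by (intro mult_mono) auto
    also have "\<dots> \<le> real (N + 2) * real (N + 2) ^ 2"
      using True by (intro mult_left_mono power_mono) auto
    finally show ?thesis
      by (simp add: power3_eq_cube power2_eq_square)
  next
    case False
    then consider "N = 0" | "N = 1" | "N = 2" | "N = 3" | "N = 4" | "N = 5" | "N = 6"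
      by linarith
    then show ?thesis
      by cases (use s_0 s1 s2 s3 s4 s5 s6 in simp_all)
  qed
  then show ?thesis
    using weight_pos[of N] by (simp add: s_def field_simps)
qed

section \<open>The estimate\<close>

lemma sum_weight_ratio_le:
  "(\<Sum>m | m + 2 \<le> n. weight m / weight n) \<le> 4 * real n ^ 4 / 2 ^ n"
proof (cases "n \<ge> 2")
  case False
  then show ?thesis
    by simp
next
  case True
  then obtain N where n: "n = N + 2"
    by (metis add.commute le_Suc_ex)
  have "{m. m + 2 \<le> n} = {..N}"
    by (auto simp: n)
  then have "real (N + 1) * (\<Sum>m | m + 2 \<le> n. weight m) * 2 ^ N \<le> real n ^ 3 * (2 ^ N * weight N)"
    using sum_weight_le[of N] by (simp add: n)
  also have "\<dots> = real (N + 1) * (real n ^ 4 * weight n)"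
    by (simp add: n flip: weight_add_2) (simp add: power_def algebra_simps)
  finally have "(\<Sum>m | m + 2 \<le> n. weight m) * 2 ^ N \<le> real n ^ 4 * weight n"
    by (simp add: mult.assoc del: of_nat_add of_nat_Suc)
  then show ?thesis
    using weight_pos[of n] by (simp add: n field_simps flip: sum_divide_distrib)
qed

text \<open>Group the permutations by their number of fixed nodes.\<close>

lemma sum_card_invariant_graphs_le:
  "(\<Sum>p\<in>{p. p permutes {0..<n}} - {id}. real (card {G \<in> labeled_graphs n. relabel p G = G}))
     \<le> 2 ^ (n choose 2) * (\<Sum>m | m + 2 \<le> n. weight m / weight n)"
proof -
  define P where "P = {p. p permutes {0..<n}} - {id}"
  define fp where "fp p = card {x \<in> {0..<n}. p x = x}" for p :: "nat \<Rightarrow> nat"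
  define v where "v m = 2 powr ((real m * (real m - 2) - real n * (real n - 2)) / 4)" for m
  have finP: "finite P"
    by (simp add: P_def finite_permutations)
  have finM: "finite {m. m + 2 \<le> n}"
    by (rule finite_subset[of _ "{..n}"]) auto
  have fp_le: "fp ` P \<subseteq> {m. m + 2 \<le> n}"
    using card_fixed_points_le[of _ "{0..<n}"] by (auto simp: P_def fp_def)
  have weight_ratio: "fact n / fact m * v m = weight m / weight n" for m
    by (simp add: weight_def v_def diff_divide_distrib powr_diff)
  have "(\<Sum>p\<in>P. real (card {G \<in> labeled_graphs n. relabel p G = G}))
      \<le> (\<Sum>p\<in>P. 2 ^ (n choose 2) * v (fp p))"
    by (intro sum_mono) (auto simp: P_def fp_def v_def intro!: card_invariant_graphs_le)
  also have "\<dots> = (\<Sum>m | m + 2 \<le> n. \<Sum>p | p \<in> P \<and> fp p = m. 2 ^ (n choose 2) * v (fp p))"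
    by (rule sum.group[OF finP finM fp_le, symmetric])
  also have "\<dots> = (\<Sum>m | m + 2 \<le> n. 2 ^ (n choose 2) * (real (card {p \<in> P. fp p = m}) * v m))"
    by (intro sum.cong refl) simp
  also have "\<dots> \<le> (\<Sum>m | m + 2 \<le> n. 2 ^ (n choose 2) * (fact n / fact m * v m))"
  proof (intro sum_mono mult_left_mono mult_right_mono)
    fix m assume "m \<in> {m. m + 2 \<le> n}"
    have "card {p \<in> P. fp p = m} \<le> card {p. p permutes {0..<n} \<and> fp p = m}"
      by (intro card_mono finite_subset[OF _ finite_permutations[of "{0..<n}"]]) (auto simp: P_def)
    also have "real \<dots> \<le> fact n / fact m"
      using card_permutations_fixing_le[of "{0..<n}" m] \<open>m \<in> {m. m + 2 \<le> n}\<close>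
      by (simp add: fp_def)
    finally show "real (card {p \<in> P. fp p = m}) \<le> fact n / fact m"
      by simp
  qed (simp_all add: v_def)
  also have "\<dots> = 2 ^ (n choose 2) * (\<Sum>m | m + 2 \<le> n. weight m / weight n)"
    by (simp only: weight_ratio sum_distrib_left)
  finally show ?thesis
    by (simp add: P_def)
qed

theorem corollary2p12:
  fixes n :: nat
  shows "2 ^ (n choose 2) / fact n \<le> real (num_unlabeled_graphs n) \<and>
         real (num_unlabeled_graphs n) \<le>
           2 ^ (n choose 2) / fact n * (1 + 4 * real n ^ 4 / 2 ^ n)"
proof -
  let ?E = "2 ^ (n choose 2) :: real"
  let ?I = "\<lambda>p. real (card {G \<in> labeled_graphs n. relabel p G = G})"
  let ?R = "\<Sum>p\<in>{p. p permutes {0..<n}} - {id}. ?I p"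
  have "?I id = ?E"
    using n_subsets[of "{0..<n}" 2]
    by (simp add: relabel_id labeled_graphs_def card_Pow flip: Pow_def)
  have "real (num_unlabeled_graphs n) * fact n = (\<Sum>p | p permutes {0..<n}. ?I p)"
    using arg_cong[OF burnside_graphs, of real] by simp
  also have "\<dots> = ?I id + ?R"
    by (rule sum.remove) (auto simp: finite_permutations permutes_id)
  finally have eq: "real (num_unlabeled_graphs n) * fact n = ?E + ?R"
    using \<open>?I id = ?E\<close> by simp
  have "?R \<le> ?E * (4 * real n ^ 4 / 2 ^ n)"
    using sum_card_invariant_graphs_le mult_left_mono[OF sum_weight_ratio_le]
    by (rule order_trans) simp
  then have "real (num_unlabeled_graphs n) * fact n \<le> ?E * (1 + 4 * real n ^ 4 / 2 ^ n)"
    using eq by (simp only: distrib_left mult_1_right)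
  moreover have "?E \<le> real (num_unlabeled_graphs n) * fact n"
    using eq by (simp add: sum_nonneg)
  ultimately show ?thesis
    by (simp add: pos_divide_le_eq pos_le_divide_eq)
qed

end
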